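(* Let $p$ be a prime and $n$ a positive integer. If $A\subseteq \mathbb{F}_p^n$ is not contained in the zero set of any nonzero polynomial in $\mathbb{F}_p[X_1,\dots,X_n]$ of degree $\le n$, then the $(p-1)$-fold sumset satisfies \[ \underbrace{A+\cdots+A}_{p-1\text{ times}}=\mathbb{F}_p^n. \]
   Context: For sets $A,B$ in an abelian group, $A+B=\{a+b: a\in A, b\in B\}$; iterated sumsets are defined analogously. *)

theory Defs
  imports
    "HOL-Analysis.Finite_Cartesian_Product"
    "HOL-Library.Poly_Mapping"
    "HOL-Library.Set_Algebras"
    "Berlekamp_Zassenhaus.Finite_Field"
begin

text \<open>
  Polynomials in the variables \<open>X\<^sub>i\<close>, \<open>i :: 'n\<close>, are formal objects (not functions): finitely
  supported maps from exponent vectors to coefficients. In particular \<open>X\<^sub>i\<^sup>p - X\<^sub>i\<close> is a nonzero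
  polynomial of degree \<open>p\<close>.
\<close>

type_synonym ('n, 'a) mvpoly = "('n \<Rightarrow>\<^sub>0 nat) \<Rightarrow>\<^sub>0 'a"

definition monomial_degree :: "('n \<Rightarrow>\<^sub>0 nat) \<Rightarrow> nat" where
  "monomial_degree m = (\<Sum>i\<in>Poly_Mapping.keys m. Poly_Mapping.lookup m i)"

text \<open>Total degree; the zero polynomial gets degree \<open>0\<close>.\<close>

definition mvpoly_degree :: "('n, 'a::zero) mvpoly \<Rightarrow> nat" where
  "mvpoly_degree f = Max (insert 0 (monomial_degree ` Poly_Mapping.keys f))"

definition mvpoly_eval :: "('n::finite, 'a::comm_semiring_1) mvpoly \<Rightarrow> 'a ^ 'n \<Rightarrow> 'a" where
  "mvpoly_eval f x =
    (\<Sum>m\<in>Poly_Mapping.keys f. Poly_Mapping.lookup f m * (\<Prod>i\<in>UNIV. (x $ i) ^ Poly_Mapping.lookup m i))"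

definition zero_set :: "('n::finite, 'a::comm_semiring_1) mvpoly \<Rightarrow> ('a ^ 'n) set" where
  "zero_set f = {x. mvpoly_eval f x = 0}"

end

theory Submission
  imports Defs
begin

text \<open>
  Write \<open>k = p - 1\<close> and \<open>n\<close> for the number of coordinates. Since no nonzero polynomial of degree
  at most \<open>n\<close> vanishes on \<open>A\<close>, the monomials of degree at most \<open>n\<close> are linearly independent as
  functions on \<open>A\<close>, so there are weights \<open>c\<close> on \<open>A\<close> such that \<open>f \<mapsto> \<Sum>a\<in>A. c a * f a\<close> maps
  \<open>X\<^sub>1 \<cdots> X\<^sub>n\<close> to \<open>1\<close> and every other monomial of degree at most \<open>n\<close> to \<open>0\<close>.
  If \<open>t\<close> is not a sum of \<open>k\<close> elements of \<open>A\<close>, then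
  \<open>\<Prod>j. \<Prod>s\<noteq>0. (x\<^sub>1\<^sub>j + \<cdots> + x\<^sub>k\<^sub>j - t\<^sub>j - s)\<close> vanishes for all \<open>x\<^sub>1, \<dots>, x\<^sub>k\<close> in \<open>A\<close>. Apply the functional in
  each of the \<open>k\<close> blocks of variables. The total degree is \<open>n k\<close>, so a monomial with a
  block of degree above \<open>n\<close> also has one of degree below \<open>n\<close> and is killed; only the
  monomial \<open>\<Prod>i j. x\<^sub>i\<^sub>j\<close> survives. Its coefficient \<open>(k!)\<^sup>n\<close> is nonzero modulo \<open>p\<close>, a contradiction.
\<close>

section \<open>Dual families of independent functions\<close>

text \<open>Induction in the style of Gram-Schmidt: an evaluation at a suitable point, corrected by
  the old dual functionals, becomes the new one, and the old ones are then corrected by it.\<close>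

lemma independent_imp_dual_family:
  fixes v :: "'m \<Rightarrow> 'x \<Rightarrow> 'a::field"
  assumes "finite M" and "finite A"
    and "\<And>f. (\<forall>x\<in>A. (\<Sum>m\<in>M. f m * v m x) = 0) \<Longrightarrow> \<forall>m\<in>M. f m = 0"
  shows "\<exists>c. \<forall>k\<in>M. \<forall>m\<in>M. (\<Sum>x\<in>A. c k x * v m x) = (if m = k then 1 else 0)"
  using assms(1,3)
proof (induction M rule: finite_induct)
  case empty
  then show ?case by simp
next
  case (insert m0 M)
  have indep: "\<forall>m\<in>M. f m = 0" if "\<forall>x\<in>A. (\<Sum>m\<in>M. f m * v m x) = 0" for f
  proof -
    have "(\<Sum>m\<in>M. (f(m0 := 0)) m * v m x) = (\<Sum>m\<in>M. f m * v m x)" for x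
      using insert.hyps by (intro sum.cong) auto
    with that insert.hyps have "\<forall>m\<in>insert m0 M. (f(m0 := 0)) m = 0"
      by (intro insert.prems) simp
    with insert.hyps show ?thesis by (metis fun_upd_apply insertCI)
  qed
  then obtain c where c: "\<And>k m. k \<in> M \<Longrightarrow> m \<in> M \<Longrightarrow>
      (\<Sum>x\<in>A. c k x * v m x) = (if m = k then 1 else 0)"
    using insert.IH by blast
  define pair where "pair k = (\<Sum>x\<in>A. c k x * v m0 x)" for k
  \<comment> \<open>Removing from \<open>v m0\<close> its components along \<open>M\<close> leaves a
    combination with coefficient 1 at \<open>m0\<close>, so independence provides a point where it
    is nonzero.\<close>
  obtain x0 where x0: "x0 \<in> A" "v m0 x0 - (\<Sum>k\<in>M. pair k * v k x0) \<noteq> 0"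
  proof -
    let ?f = "\<lambda>m. if m = m0 then 1 else - pair m"
    have eq: "(\<Sum>m\<in>insert m0 M. ?f m * v m x) = v m0 x - (\<Sum>k\<in>M. pair k * v k x)" for x
    proof -
      have "(\<Sum>m\<in>M. ?f m * v m x) = (\<Sum>m\<in>M. - (pair m * v m x))"
        using insert.hyps by (intro sum.cong) auto
      with insert.hyps show ?thesis by (simp add: sum_negf)
    qed
    have "\<not> (\<forall>m\<in>insert m0 M. ?f m = 0)" by simp
    then show ?thesis using insert.prems[of ?f] that unfolding eq by blast
  qed
  define r where "r = v m0 x0 - (\<Sum>k\<in>M. pair k * v k x0)"
  \<comment> \<open>Evaluation at \<open>x0\<close>, minus the combination of the \<open>c k\<close>
    that agrees with it on \<open>M\<close>; dividing by \<open>r\<close> gives the value 1 on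
    \<open>v m0\<close>.\<close>
  define d where "d x = ((if x = x0 then 1 else 0) - (\<Sum>k\<in>M. v k x0 * c k x)) / r" for x
  have d: "(\<Sum>x\<in>A. d x * v m x) = (v m x0 - (\<Sum>k\<in>M. v k x0 * (\<Sum>x\<in>A. c k x * v m x))) / r" for m
  proof -
    have "(\<Sum>x\<in>A. d x * v m x)
        = (\<Sum>x\<in>A. (if x = x0 then v m x else 0) - (\<Sum>k\<in>M. v k x0 * c k x * v m x)) / r"
      unfolding sum_divide_distrib
      by (intro sum.cong) (auto simp: d_def diff_divide_distrib left_diff_distrib sum_distrib_right)
    also have "\<dots> = (v m x0 - (\<Sum>x\<in>A. \<Sum>k\<in>M. v k x0 * c k x * v m x)) / r"
      using \<open>finite A\<close> x0(1) by (simp add: sum_subtractf)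
    also have "(\<Sum>x\<in>A. \<Sum>k\<in>M. v k x0 * c k x * v m x) = (\<Sum>k\<in>M. v k x0 * (\<Sum>x\<in>A. c k x * v m x))"
      by (subst sum.swap) (simp add: sum_distrib_left mult.assoc)
    finally show ?thesis .
  qed
  have d_M: "(\<Sum>x\<in>A. d x * v m x) = 0" if "m \<in> M" for m
  proof -
    have "(\<Sum>k\<in>M. v k x0 * (\<Sum>x\<in>A. c k x * v m x)) = (\<Sum>k\<in>M. if m = k then v k x0 else 0)"
      using that by (intro sum.cong) (auto simp: c)
    with that insert.hyps show ?thesis by (simp add: d)
  qed
  have d_m0: "(\<Sum>x\<in>A. d x * v m0 x) = 1"
    using x0(2) unfolding d by (simp add: r_def pair_def[symmetric] mult.commute)
  \<comment> \<open>Since \<open>d\<close> vanishes on \<open>M\<close>, subtracting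
    \<open>pair k * d\<close> kills the value on \<open>v m0\<close> and changes nothing on
    \<open>M\<close>.\<close>
  define c' where "c' k x = (if k = m0 then d x else c k x - pair k * d x)" for k x
  have "(\<Sum>x\<in>A. c' k x * v m x) = (if m = k then 1 else 0)"
    if km: "k \<in> insert m0 M" "m \<in> insert m0 M" for k m
  proof (cases "k = m0")
    case True
    then show ?thesis using km insert.hyps d_M d_m0 by (auto simp: c'_def)
  next
    case False
    then have "(\<Sum>x\<in>A. c' k x * v m x) = (\<Sum>x\<in>A. c k x * v m x) - pair k * (\<Sum>x\<in>A. d x * v m x)"
      by (simp add: c'_def left_diff_distrib sum_subtractf sum_distrib_left mult.assoc)
    then show ?thesis using km False insert.hyps d_M d_m0 c by (auto simp: pair_def)
  qed
  then show ?case by blast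
qed

section \<open>Functionals on monomials of bounded degree\<close>

lemma monomial_degree_eq_sum:
  fixes m :: "'n::finite \<Rightarrow>\<^sub>0 nat"
  shows "monomial_degree m = (\<Sum>i\<in>UNIV. Poly_Mapping.lookup m i)"
  unfolding monomial_degree_def by (intro sum.mono_neutral_left) (auto simp: in_keys_iff)

lemma finite_monomial_degree_le: "finite {m :: 'n::finite \<Rightarrow>\<^sub>0 nat. monomial_degree m \<le> d}"
proof (rule finite_imageD)
  have "Poly_Mapping.lookup m i \<le> monomial_degree m" for m :: "'n \<Rightarrow>\<^sub>0 nat" and i
    unfolding monomial_degree_eq_sum by (rule member_le_sum) auto
  then have "Poly_Mapping.lookup ` {m :: 'n \<Rightarrow>\<^sub>0 nat. monomial_degree m \<le> d} \<subseteq> UNIV \<rightarrow>\<^sub>E {..d}"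
    by (auto intro: order_trans)
  then show "finite (Poly_Mapping.lookup ` {m :: 'n \<Rightarrow>\<^sub>0 nat. monomial_degree m \<le> d})"
    by (rule finite_subset) (simp add: finite_PiE)
  show "inj_on Poly_Mapping.lookup {m :: 'n \<Rightarrow>\<^sub>0 nat. monomial_degree m \<le> d}"
    by (auto intro: inj_onI poly_mapping_eqI)
qed

text \<open>A linear relation on \<open>A\<close> among monomials of degree at most \<open>d\<close>
  is a polynomial vanishing on \<open>A\<close>; the hypothesis thus says that they are independent
  there, and the weights come from their dual family.\<close>

lemma monomial_functional_exists:
  fixes A :: "('a::field ^ 'n::finite) set" and e0 :: "'n \<Rightarrow> nat"
  assumes fin: "finite A"
    and A: "\<not> (\<exists>f :: ('n, 'a) mvpoly. f \<noteq> 0 \<and> mvpoly_degree f \<le> d \<and> A \<subseteq> zero_set f)"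
    and e0: "(\<Sum>j\<in>UNIV. e0 j) \<le> d"
  shows "\<exists>c. \<forall>e. (\<Sum>j\<in>UNIV. e j) \<le> d \<longrightarrow>
           (\<Sum>a\<in>A. c a * (\<Prod>j\<in>UNIV. (a $ j) ^ e j)) = (if e = e0 then 1 else 0)"
proof -
  define M where "M = {m :: 'n \<Rightarrow>\<^sub>0 nat. monomial_degree m \<le> d}"
  have finM: "finite M" unfolding M_def by (rule finite_monomial_degree_le)
  define v where "v m x = (\<Prod>i\<in>UNIV. (x $ i) ^ Poly_Mapping.lookup m i)"
    for m and x :: "'a ^ 'n"
  have indep: "\<forall>m\<in>M. f m = 0" if f: "\<forall>x\<in>A. (\<Sum>m\<in>M. f m * v m x) = 0" for f
  proof (rule ccontr)
    assume "\<not> (\<forall>m\<in>M. f m = 0)"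
    then obtain m1 where m1: "m1 \<in> M" "f m1 \<noteq> 0" by blast
    define g :: "('n, 'a) mvpoly" where "g = Abs_poly_mapping (\<lambda>m. if m \<in> M then f m else 0)"
    have "finite {m. (if m \<in> M then f m else 0) \<noteq> 0}"
      by (rule finite_subset[OF _ finM]) auto
    then have g: "Poly_Mapping.lookup g = (\<lambda>m. if m \<in> M then f m else 0)"
      unfolding g_def by simp
    have keys: "Poly_Mapping.keys g \<subseteq> M" by (auto simp: in_keys_iff g split: if_splits)
    have "g \<noteq> 0" using m1 g by (metis lookup_zero)
    moreover have "mvpoly_degree g \<le> d"
      unfolding mvpoly_degree_def using keys by (auto simp: M_def)
    moreover have "mvpoly_eval g x = (\<Sum>m\<in>M. f m * v m x)" for x
    proof -
      have "mvpoly_eval g x = (\<Sum>m\<in>M. Poly_Mapping.lookup g m * v m x)"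
        unfolding mvpoly_eval_def v_def
        by (intro sum.mono_neutral_left finM keys) (auto simp: in_keys_iff)
      also have "\<dots> = (\<Sum>m\<in>M. f m * v m x)" by (intro sum.cong) (auto simp: g)
      finally show ?thesis .
    qed
    then have "A \<subseteq> zero_set g" using f by (auto simp: zero_set_def)
    ultimately show False using A by blast
  qed
  have lookup: "Poly_Mapping.lookup (Abs_poly_mapping e) = e" for e :: "'n \<Rightarrow> nat"
    by simp
  have in_M: "Abs_poly_mapping e \<in> M" if "(\<Sum>j\<in>UNIV. e j) \<le> d" for e
    using that by (simp add: M_def monomial_degree_eq_sum)
  obtain c where c: "\<And>k m. k \<in> M \<Longrightarrow> m \<in> M \<Longrightarrow>
      (\<Sum>x\<in>A. c k x * v m x) = (if m = k then 1 else 0)"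
    using independent_imp_dual_family[OF finM fin, of v] indep by blast
  have "(\<Sum>a\<in>A. c (Abs_poly_mapping e0) a * (\<Prod>j\<in>UNIV. (a $ j) ^ e j)) = (if e = e0 then 1 else 0)"
    if e: "(\<Sum>j\<in>UNIV. e j) \<le> d" for e
  proof -
    have "Abs_poly_mapping e = Abs_poly_mapping e0 \<longleftrightarrow> e = e0" by (metis lookup)
    then show ?thesis using c[OF in_M[OF e0] in_M[OF e]] by (simp add: v_def)
  qed
  then show ?thesis by blast
qed

section \<open>Counting bijections\<close>

lemma card_injections_fact:
  assumes "finite K" "finite I" "card K = card I"
  shows "card {f \<in> K \<rightarrow>\<^sub>E I. inj_on f K} = fact (card I)"
  using card_inj_on_subset_funcset[OF assms(1,2) order_refl] assms(3)
  by (simp add: fact_prod_rev)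

lemma inj_on_iff_card_fibres:
  assumes "finite K" "finite I" "card K = card I"
  shows "f \<in> K \<rightarrow> I \<and> inj_on f K \<longleftrightarrow> (\<forall>i\<in>I. card {s\<in>K. f s = i} = 1)" (is "?L \<longleftrightarrow> ?R")
proof
  assume L: ?L
  then have "f ` K = I"
    using assms by (intro card_subset_eq) (auto simp: card_image)
  show ?R
  proof
    fix i assume "i \<in> I"
    then obtain s where "s \<in> K" "f s = i" using \<open>f ` K = I\<close> by blast
    then have "{s\<in>K. f s = i} = {s}" using L by (auto dest: inj_onD)
    then show "card {s\<in>K. f s = i} = 1" by simp
  qed
next
  assume R: ?R
  have sub: "I \<subseteq> f ` K"
  proof
    fix i assume "i \<in> I"
    then have "{s\<in>K. f s = i} \<noteq> {}" using R by (metis card.empty zero_neq_one)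
    then show "i \<in> f ` K" by blast
  qed
  have "card (f ` K) \<le> card I" using assms card_image_le by metis
  then have "f ` K = I" using sub assms(1) by (metis card_seteq finite_imageI)
  moreover have "inj_on f K"
    using assms(1,3) \<open>f ` K = I\<close> by (intro eq_card_imp_inj_on) auto
  ultimately show ?L by blast
qed

section \<open>Product expansion and blockwise functionals\<close>

text \<open>Nothing is known of \<open>h\<close> above degree \<open>CARD('n)\<close>. If no block
  gives a factor 0, each has degree at least \<open>CARD('n)\<close>; the total bound then forces
  equality, so every block is the all-ones exponent.\<close>

lemma prod_block_functional:
  fixes e :: "'i \<Rightarrow> 'n::finite \<Rightarrow> nat" and h :: "('n \<Rightarrow> nat) \<Rightarrow> 'a::comm_semiring_1"
  assumes "finite I"
    and h: "\<And>u. (\<Sum>j\<in>UNIV. u j) \<le> CARD('n) \<Longrightarrow> h u = (if u = (\<lambda>_. 1) then 1 else 0)"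
    and deg: "(\<Sum>i\<in>I. \<Sum>j\<in>UNIV. e i j) \<le> card I * CARD('n)"
  shows "(\<Prod>i\<in>I. h (e i)) = (if \<forall>i\<in>I. \<forall>j. e i j = 1 then 1 else 0)"
proof (cases "\<exists>i\<in>I. (\<Sum>j\<in>UNIV. e i j) \<le> CARD('n) \<and> e i \<noteq> (\<lambda>_. 1)")
  case True
  then obtain i where i: "i \<in> I" "(\<Sum>j\<in>UNIV. e i j) \<le> CARD('n)" "e i \<noteq> (\<lambda>_. 1)" by blast
  then have "h (e i) = 0" using h by simp
  then have "(\<Prod>i\<in>I. h (e i)) = 0" using \<open>finite I\<close> i(1) by (intro prod_zero) auto
  with i show ?thesis by (auto simp: fun_eq_iff)
next
  case False
  have ge: "CARD('n) \<le> (\<Sum>j\<in>UNIV. e i j)" if "i \<in> I" for i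
  proof (cases "e i = (\<lambda>_. 1)")
    case True then show ?thesis by simp
  next
    case ne: False
    then show ?thesis using False that by force
  qed
  have "(\<Sum>j\<in>UNIV. e i j) \<le> CARD('n)" if "i \<in> I" for i
  proof (rule ccontr)
    assume "\<not> ?thesis"
    then have "(\<Sum>i\<in>I. CARD('n)) < (\<Sum>i\<in>I. \<Sum>j\<in>UNIV. e i j)"
      using \<open>finite I\<close> ge that by (intro sum_strict_mono_ex1) (auto simp: not_le)
    with deg show False by simp
  qed
  with False have "e i = (\<lambda>_. 1)" if "i \<in> I" for i using that by blast
  then show ?thesis using h by simp
qed

lemma prod_choice_eq:
  fixes y :: "'i \<Rightarrow> 'a::comm_semiring_1"
  assumes "finite K" "finite I" "f \<in> K \<rightarrow> insert None (Some ` I)"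
  shows "(\<Prod>s\<in>K. case f s of None \<Rightarrow> b s | Some i \<Rightarrow> y i)
       = (\<Prod>s\<in>K. if f s = None then b s else 1) * (\<Prod>i\<in>I. y i ^ card {s\<in>K. f s = Some i})"
proof -
  \<comment> \<open>Padding with factors 1 makes both index sets independent, so the products can be
    swapped.\<close>
  have "(\<Prod>i\<in>I. y i ^ card {s\<in>K. f s = Some i}) = (\<Prod>i\<in>I. \<Prod>s\<in>K. if f s = Some i then y i else 1)"
    using assms(1) by (simp add: prod.If_cases Int_def)
  also have "\<dots> = (\<Prod>s\<in>K. \<Prod>i\<in>I. if f s = Some i then y i else 1)"
    by (rule prod.swap)
  finally have eq: "(\<Prod>i\<in>I. y i ^ card {s\<in>K. f s = Some i}) = \<dots>" .
  have "(case f s of None \<Rightarrow> b s | Some i \<Rightarrow> y i)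
      = (if f s = None then b s else 1) * (\<Prod>i\<in>I. if f s = Some i then y i else 1)"
    if "s \<in> K" for s
  proof (cases "f s")
    case (Some i)
    then have "i \<in> I" using that assms(3) by (metis PiE Pi_mem imageE insertE option.distinct(1) option.inject)
    have "(\<Prod>i'\<in>I. if i = i' then y i' else 1) = y i"
      using \<open>i \<in> I\<close> assms(2) by simp
    with Some show ?thesis by simp
  qed simp
  then show ?thesis unfolding eq prod.distrib[symmetric] by (intro prod.cong) auto
qed

text \<open>
  Expanding the product, each factor \<open>(j, s)\<close> chooses either its constant term (\<open>None\<close>) or the
  variable \<open>x i $ j\<close> (\<open>Some i\<close>).
\<close>

lemma tensor_functional_prod_linear:
  fixes c :: "'a::comm_ring_1 ^ 'n::finite \<Rightarrow> 'a" and I :: "'i set" and K :: "'k set"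
  assumes fin: "finite A" "finite I" "finite K" and card: "card K = card I"
    and c: "\<And>e. (\<Sum>j\<in>UNIV. e j) \<le> CARD('n) \<Longrightarrow>
      (\<Sum>a\<in>A. c a * (\<Prod>j\<in>UNIV. (a $ j) ^ e j)) = (if e = (\<lambda>_. 1) then 1 else 0)"
  shows "(\<Sum>x\<in>I \<rightarrow>\<^sub>E A. (\<Prod>i\<in>I. c (x i)) * (\<Prod>j\<in>UNIV. \<Prod>s\<in>K. (\<Sum>i\<in>I. x i $ j) + b j s))
       = of_nat (fact (card I)) ^ CARD('n)"
proof -
  define O' where "O' = insert None (Some ` I)"
  have finO: "finite O'" using fin by (simp add: O'_def)
  define Fs where "Fs = (UNIV :: 'n set) \<rightarrow>\<^sub>E (K \<rightarrow>\<^sub>E O')"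
  have finFs: "finite Fs" using fin finO by (simp add: Fs_def finite_PiE)
  \<comment> \<open>The exponent of \<open>x i $ j\<close> in the term selected by \<phi>;
    \<open>w\<close> collects the constants of that term.\<close>
  define e where "e \<phi> i j = card {s\<in>K. \<phi> j s = Some i}" for \<phi> :: "'n \<Rightarrow> 'k \<Rightarrow> 'i option" and i j
  define w where "w \<phi> = (\<Prod>j\<in>UNIV. \<Prod>s\<in>K. if \<phi> j s = None then b j s else 1)"
    for \<phi> :: "'n \<Rightarrow> 'k \<Rightarrow> 'i option"
  define h where "h u = (\<Sum>a\<in>A. c a * (\<Prod>j\<in>UNIV. (a $ j) ^ u j))" for u
  define good where "good \<phi> \<longleftrightarrow> (\<forall>i\<in>I. \<forall>j. e \<phi> i j = 1)" for \<phi>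
  have expand: "(\<Prod>j\<in>UNIV. \<Prod>s\<in>K. (\<Sum>i\<in>I. x i $ j) + b j s)
      = (\<Sum>\<phi>\<in>Fs. w \<phi> * (\<Prod>i\<in>I. \<Prod>j\<in>UNIV. (x i $ j) ^ e \<phi> i j))" for x
  proof -
    define y where "y j s o' = (case o' of None \<Rightarrow> b j s | Some i \<Rightarrow> x i $ j)" for j s o'
    have "(\<Sum>i\<in>I. x i $ j) + b j s = (\<Sum>o'\<in>O'. y j s o')" for j s
      using fin by (simp add: O'_def y_def sum.reindex add.commute)
    then have "(\<Prod>j\<in>UNIV. \<Prod>s\<in>K. (\<Sum>i\<in>I. x i $ j) + b j s)
        = (\<Prod>j\<in>UNIV. \<Sum>f\<in>K \<rightarrow>\<^sub>E O'. \<Prod>s\<in>K. y j s (f s))"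
      using fin finO by (simp add: prod_sum_PiE)
    also have "\<dots> = (\<Sum>\<phi>\<in>Fs. \<Prod>j\<in>UNIV. \<Prod>s\<in>K. y j s (\<phi> j s))"
      unfolding Fs_def using fin finO by (intro prod_sum_PiE) (auto intro!: finite_PiE)
    also have "\<dots> = (\<Sum>\<phi>\<in>Fs. w \<phi> * (\<Prod>i\<in>I. \<Prod>j\<in>UNIV. (x i $ j) ^ e \<phi> i j))"
    proof (rule sum.cong[OF refl])
      fix \<phi> assume "\<phi> \<in> Fs"
      then have "\<phi> j \<in> K \<rightarrow> insert None (Some ` I)" for j
        by (auto simp: Fs_def O'_def PiE_iff)
      then have "(\<Prod>j\<in>UNIV. \<Prod>s\<in>K. y j s (\<phi> j s))
          = (\<Prod>j\<in>UNIV. (\<Prod>s\<in>K. if \<phi> j s = None then b j s else 1) * (\<Prod>i\<in>I. (x i $ j) ^ e \<phi> i j))"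
        unfolding y_def e_def using fin by (intro prod.cong refl prod_choice_eq)
      also have "\<dots> = w \<phi> * (\<Prod>i\<in>I. \<Prod>j\<in>UNIV. (x i $ j) ^ e \<phi> i j)"
        unfolding prod.distrib w_def by (subst prod.swap) simp
      finally show "(\<Prod>j\<in>UNIV. \<Prod>s\<in>K. y j s (\<phi> j s)) = \<dots>" .
    qed
    finally show ?thesis .
  qed
  have "(\<Sum>x\<in>I \<rightarrow>\<^sub>E A. (\<Prod>i\<in>I. c (x i)) * (\<Prod>j\<in>UNIV. \<Prod>s\<in>K. (\<Sum>i\<in>I. x i $ j) + b j s))
      = (\<Sum>\<phi>\<in>Fs. \<Sum>x\<in>I \<rightarrow>\<^sub>E A. w \<phi> * (\<Prod>i\<in>I. c (x i) * (\<Prod>j\<in>UNIV. (x i $ j) ^ e \<phi> i j)))"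
    unfolding expand sum_distrib_left by (subst sum.swap) (simp add: prod.distrib mult_ac)
  also have "\<dots> = (\<Sum>\<phi>\<in>Fs. w \<phi> * (\<Prod>i\<in>I. h (e \<phi> i)))"
    unfolding h_def sum_distrib_left[symmetric] using fin by (subst prod_sum_PiE) auto
  also have "\<dots> = (\<Sum>\<phi>\<in>Fs. if good \<phi> then 1 else 0)"
  proof (rule sum.cong[OF refl])
    fix \<phi> assume "\<phi> \<in> Fs"
    \<comment> \<open>For fixed \<open>j\<close> the exponents count disjoint subsets of
      \<open>K\<close>, which bounds the total degree.\<close>
    have "(\<Sum>i\<in>I. e \<phi> i j) \<le> card I" for j
    proof -
      have "(\<Sum>i\<in>I. e \<phi> i j) = card (\<Union>i\<in>I. {s\<in>K. \<phi> j s = Some i})"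
        unfolding e_def using fin by (intro card_UN_disjoint[symmetric]) auto
      also have "\<dots> \<le> card K" using fin by (intro card_mono) auto
      finally show ?thesis using card by simp
    qed
    then have "(\<Sum>j\<in>UNIV. \<Sum>i\<in>I. e \<phi> i j) \<le> (\<Sum>j\<in>(UNIV :: 'n set). card I)"
      by (intro sum_mono)
    then have "(\<Sum>i\<in>I. \<Sum>j\<in>UNIV. e \<phi> i j) \<le> card I * CARD('n)"
      by (subst sum.swap) (simp add: mult.commute)
    then have "(\<Prod>i\<in>I. h (e \<phi> i)) = (if good \<phi> then 1 else 0)"
      unfolding good_def using c fin by (intro prod_block_functional) (auto simp: h_def)
    \<comment> \<open>In a good term the variables use up all of \<open>K\<close>, as
      \<open>card K = card I\<close>, so no constant is chosen.\<close>
    moreover have "w \<phi> = 1" if "good \<phi>"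
    proof -
      have "\<phi> j \<in> K \<rightarrow> Some ` I" for j
        using that inj_on_iff_card_fibres[of K "Some ` I" "\<phi> j"] fin card
        by (auto simp: good_def e_def card_image)
      then have "\<phi> j s \<noteq> None" if "s \<in> K" for j s using that by fastforce
      then show ?thesis unfolding w_def by (intro prod.neutral ballI) (simp only: if_False)
    qed
    ultimately show "w \<phi> * (\<Prod>i\<in>I. h (e \<phi> i)) = (if good \<phi> then 1 else 0)" by simp
  qed
  also have "\<dots> = of_nat (card {\<phi>\<in>Fs. good \<phi>})"
    using finFs by (simp add: sum.If_cases Int_def)
  also have "{\<phi>\<in>Fs. good \<phi>} = UNIV \<rightarrow>\<^sub>E {f \<in> K \<rightarrow>\<^sub>E Some ` I. inj_on f K}"
  proof -
    have "good \<phi> \<longleftrightarrow> (\<forall>j. \<phi> j \<in> K \<rightarrow> Some ` I \<and> inj_on (\<phi> j) K)" for \<phi>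
      using inj_on_iff_card_fibres[of K "Some ` I"] fin card
      by (auto simp: good_def e_def card_image)
    then show ?thesis by (auto simp: Fs_def O'_def PiE_iff Pi_iff)
  qed
  also have "card \<dots> = fact (card I) ^ CARD('n)"
    using fin card by (simp add: card_PiE card_injections_fact card_image)
  finally show ?thesis by simp
qed

section \<open>The contradiction modulo p\<close>

lemma of_nat_fact_mod_ring_neq_0:
  assumes "k < CARD('p)"
  shows "of_nat (fact k) \<noteq> (0 :: 'p::prime_card mod_ring)"
  using assms of_nat_0_mod_ring_dvd[where 'a = 'p, of "fact k"]
  by (auto simp: prime_dvd_fact_iff[OF prime_card])

theorem theorem1p2:
  fixes A :: "('p::prime_card mod_ring ^ 'n::finite) set"
  assumes "\<not> (\<exists>f :: ('n, 'p mod_ring) mvpoly.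
              f \<noteq> 0 \<and> mvpoly_degree f \<le> CARD('n) \<and> A \<subseteq> zero_set f)"
  shows "(\<Sum>i = 1..CARD('p) - 1. A) = (UNIV :: ('p mod_ring ^ 'n) set)"
proof (rule ccontr)
  assume contra: "\<not> ?thesis"
  define I where "I = {1..CARD('p) - 1}"
  \<comment> \<open>The product of \<open>z - s\<close> over nonzero \<open>s\<close> vanishes
    exactly when \<open>z\<close> is nonzero; \<open>K\<close> also has the p - 1 elements needed to
    match \<open>I\<close>.\<close>
  define K where "K = UNIV - {0 :: 'p mod_ring}"
  have card: "card K = card I" by (simp add: K_def I_def card_Diff_singleton)
  obtain t where t: "t \<notin> (\<Sum>i\<in>I. A)" using contra by (auto simp: I_def)
  obtain c where c: "\<And>e. (\<Sum>j\<in>UNIV. e j) \<le> CARD('n) \<Longrightarrow>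
      (\<Sum>a\<in>A. c a * (\<Prod>j\<in>UNIV. (a $ j) ^ e j)) = (if e = (\<lambda>_. 1) then 1 else 0)"
    using monomial_functional_exists[OF _ assms, of "\<lambda>_. 1"] by auto
  \<comment> \<open>A sum that misses \<open>t\<close> differs from it in some coordinate
    \<open>j\<close>; the factor whose \<open>s\<close> is that difference is 0.\<close>
  have vanish: "(\<Prod>j\<in>UNIV. \<Prod>s\<in>K. (\<Sum>i\<in>I. x i $ j) + (- t $ j - s)) = 0" if "x \<in> I \<rightarrow>\<^sub>E A" for x
  proof -
    have "(\<Sum>i\<in>I. x i) \<noteq> t" using that t by (auto simp: set_sum_alt I_def PiE_iff)
    then obtain j where j: "(\<Sum>i\<in>I. x i $ j) \<noteq> t $ j" by (auto simp: vec_eq_iff)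
    then have "(\<Sum>i\<in>I. x i $ j) - t $ j \<in> K" by (simp add: K_def)
    then have "(\<Prod>s\<in>K. (\<Sum>i\<in>I. x i $ j) + (- t $ j - s)) = 0"
      by (intro prod_zero) (auto intro!: bexI[of _ "(\<Sum>i\<in>I. x i $ j) - t $ j"])
    then show ?thesis by (intro prod_zero) auto
  qed
  have "of_nat (fact (card I)) ^ CARD('n) = (\<Sum>x\<in>I \<rightarrow>\<^sub>E A. (\<Prod>i\<in>I. c (x i)) *
      (\<Prod>j\<in>UNIV. \<Prod>s\<in>K. (\<Sum>i\<in>I. x i $ j) + (- t $ j - s)))"
    by (rule tensor_functional_prod_linear[symmetric]) (use card c in \<open>auto simp: I_def\<close>)
  also have "\<dots> = 0"
    by (intro sum.neutral ballI) (simp only: vanish mult_zero_right)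
  finally have "of_nat (fact (card I)) ^ CARD('n) = (0 :: 'p mod_ring)" .
  moreover have "card I < CARD('p)" by (simp add: I_def)
  ultimately show False using of_nat_fact_mod_ring_neq_0[where 'p = 'p] by simp
qed

end
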